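(* Let $\delta t>0$ be arbitrary, and let $(D_1^k,D_2^k)_{k\ge 0}$ be a sequence of pairs of sets generated by Algorithm I with time step $\delta t$ (respectively, by Algorithm II with time step $\delta t$), both algorithms being described in the context. Put $(u_1^k,u_2^k)=(\chi_{D_1^k},\chi_{D_2^k})$. Then for every $k$ for which the iterates $k$ and $k+1$ are generated, $$\mathcal{E}^{\delta t}(u_1^{k+1},u_2^{k+1})\le \mathcal{E}^{\delta t}(u_1^{k},u_2^{k}).$$
   Context: Let $n\in\{2,3\}$, let $\Omega\subset\mathbb{R}^n$ be a bounded domain (fluid region) and let $D_3\subset\mathbb{R}^n$ be a bounded measurable set (solid region) disjoint from $\Omega$. Put $\tilde\Omega=\Omega\cup D_3$. Let $\gamma_{LV}>0$ and $\gamma_{SL},\gamma_{SV}$ be real constants with $-1<\frac{\gamma_{SV}-\gamma_{SL}}{\gamma_{LV}}<1$, and let $\theta_Y\in(0,\pi)$ be defined by $\cos\theta_Y=\frac{\gamma_{SV}-\gamma_{SL}}{\gamma_{LV}}$. Fix $0<V_0<|\Omega|$, where $|\cdot|$ is Lebesgue measure. For $\delta t>0$ let $G_{\delta t}(\mathbf{x})=\frac{1}{(4\pi\delta t)^{n/2}}\exp\left(-\frac{|\mathbf{x}|^2}{4\delta t}\right)$ and let $*$ be convolution on $\mathbb{R}^n$; functions defined on $\Omega$ are extended by zero outside $\Omega$. $\chi_D$ denotes the characteristic function of $D$. Energy: $$\mathcal{E}^{\delta t}(u_1,u_2)=\frac{\gamma_{LV}}{\sqrt{\delta t}}\int_{\tilde\Omega}u_1\,G_{\delta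 t}*u_2\,d\mathbf{x}+\frac{\gamma_{SL}}{\sqrt{\delta t}}\int_{\tilde\Omega}u_1\,G_{\delta t}*\chi_{D_3}\,d\mathbf{x}+\frac{\gamma_{SV}}{\sqrt{\delta t}}\int_{\tilde\Omega}u_2\,G_{\delta t}*\chi_{D_3}\,d\mathbf{x}.$$ Both algorithms start from measurable sets $D_1^0,D_2^0\subset\Omega$ with $D_1^0\cap D_2^0=\emptyset$, $D_1^0\cup D_2^0=\Omega$, $|D_1^0|=V_0$. Algorithm I, one iteration: given $(D_1^k,D_2^k)$, set $$\phi_1=\frac{1}{\sqrt{\delta t}}G_{\delta t}*(\gamma_{LV}\chi_{D_2^k}+\gamma_{SL}\chi_{D_3}),\qquad \phi_2=\frac{1}{\sqrt{\delta t}}G_{\delta t}*(\gamma_{LV}\chi_{D_1^k}+\gamma_{SV}\chi_{D_3});$$ find $\delta\in\mathbb{R}$ such that $\tilde D_1^\delta=\{x\in\Omega:\phi_1(x)<\phi_2(x)+\delta\}$ satisfies $|\tilde D_1^\delta|=V_0$; set $D_1^{k+1}=\tilde D_1^\delta$ and $D_2^{k+1}=\Omega\setminus D_1^{k+1}$. Algorithm II, one iteration: given $D_1^k$ and $D_2^k=\Omega\setminus D_1^k$, set $$\phi=\frac{\gamma_{LV}}{\sqrt{\delta t}}G_{\delta t}*(\chi_{D_2^k}-\chi_{D_1^k}-\cos\theta_Y\,\chi_{D_3});$$ find $\delta\in\mathbb{R}$ such that $\tilde D_1^\delta=\{x\in\Omega:\phi(x)<\delta\}$ satisfies $|\tilde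 D_1^\delta|=V_0$; set $D_1^{k+1}=\tilde D_1^\delta$ and $D_2^{k+1}=\Omega\setminus D_1^{k+1}$. (The algorithms are stopped when $|D_1^k-D_1^{k+1}|$ is at most a prescribed tolerance; this only determines how many iterates are generated.) *)

theory Defs
  imports "HOL-Analysis.Analysis" "HOL-Library.Extended_Nat"
begin

definition heat_kernel :: "real \<Rightarrow> real ^ 'n \<Rightarrow> real" where
  "heat_kernel t x =
     1 / (4 * pi * t) powr (real CARD('n) / 2) * exp (- (norm x)\<^sup>2 / (4 * t))"

text \<open>All integrals are with respect to \<^term>\<open>lebesgue\<close> (not \<^term>\<open>lborel\<close>), since the sets
  involved are only assumed Lebesgue measurable.\<close>

definition convolution :: "(real ^ 'n \<Rightarrow> real) \<Rightarrow> (real ^ 'n \<Rightarrow> real) \<Rightarrow> real ^ 'n \<Rightarrow> real"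
    (infixl "\<star>" 75) where
  "(f \<star> g) x = (LINT y|lebesgue. f (x - y) * g y)"

definition zero_ext :: "(real ^ 'n) set \<Rightarrow> (real ^ 'n \<Rightarrow> real) \<Rightarrow> real ^ 'n \<Rightarrow> real" where
  "zero_ext \<Omega> u x = (if x \<in> \<Omega> then u x else 0)"

text \<open>The phase functions \<open>u1\<close>, \<open>u2\<close> are functions on \<open>\<Omega>\<close>: their values outside \<open>\<Omega>\<close> are
  irrelevant, because they are extended by zero.\<close>

definition energy :: "(real ^ 'n) set \<Rightarrow> (real ^ 'n) set \<Rightarrow> real \<Rightarrow> real \<Rightarrow> real \<Rightarrow> real
    \<Rightarrow> (real ^ 'n \<Rightarrow> real) \<Rightarrow> (real ^ 'n \<Rightarrow> real) \<Rightarrow> real" where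
  "energy \<Omega> D3 \<gamma>LV \<gamma>SL \<gamma>SV \<delta>t u1 u2 =
     \<gamma>LV / sqrt \<delta>t *
       (LINT x:(\<Omega> \<union> D3)|lebesgue. zero_ext \<Omega> u1 x * (heat_kernel \<delta>t \<star> zero_ext \<Omega> u2) x)
   + \<gamma>SL / sqrt \<delta>t *
       (LINT x:(\<Omega> \<union> D3)|lebesgue. zero_ext \<Omega> u1 x * (heat_kernel \<delta>t \<star> indicator D3) x)
   + \<gamma>SV / sqrt \<delta>t *
       (LINT x:(\<Omega> \<union> D3)|lebesgue. zero_ext \<Omega> u2 x * (heat_kernel \<delta>t \<star> indicator D3) x)"

definition initial_partition ::
    "(real ^ 'n) set \<Rightarrow> real \<Rightarrow> (real ^ 'n) set \<Rightarrow> (real ^ 'n) set \<Rightarrow> bool" where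
  "initial_partition \<Omega> V0 D1 D2 \<longleftrightarrow>
     D1 \<in> sets lebesgue \<and> D2 \<in> sets lebesgue \<and>
     D1 \<inter> D2 = {} \<and> D1 \<union> D2 = \<Omega> \<and> measure lebesgue D1 = V0"

definition phi1 :: "(real ^ 'n) set \<Rightarrow> real \<Rightarrow> real \<Rightarrow> real \<Rightarrow> (real ^ 'n) set \<Rightarrow> real ^ 'n \<Rightarrow> real"
  where
  "phi1 D3 \<gamma>LV \<gamma>SL \<delta>t D2 x =
     1 / sqrt \<delta>t * (heat_kernel \<delta>t \<star> (\<lambda>y. \<gamma>LV * indicator D2 y + \<gamma>SL * indicator D3 y)) x"

definition phi2 :: "(real ^ 'n) set \<Rightarrow> real \<Rightarrow> real \<Rightarrow> real \<Rightarrow> (real ^ 'n) set \<Rightarrow> real ^ 'n \<Rightarrow> real"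
  where
  "phi2 D3 \<gamma>LV \<gamma>SV \<delta>t D1 x =
     1 / sqrt \<delta>t * (heat_kernel \<delta>t \<star> (\<lambda>y. \<gamma>LV * indicator D1 y + \<gamma>SV * indicator D3 y)) x"

definition phi :: "(real ^ 'n) set \<Rightarrow> real \<Rightarrow> real \<Rightarrow> real
    \<Rightarrow> (real ^ 'n) set \<Rightarrow> (real ^ 'n) set \<Rightarrow> real ^ 'n \<Rightarrow> real" where
  "phi D3 \<gamma>LV \<theta>Y \<delta>t D1 D2 x =
     \<gamma>LV / sqrt \<delta>t *
       (heat_kernel \<delta>t \<star> (\<lambda>y. indicator D2 y - indicator D1 y - cos \<theta>Y * indicator D3 y)) x"

text \<open>One iteration is a relation between the current pair \<open>(D1, D2)\<close> and the next pair
  \<open>(D1', D2')\<close>: the level \<open>\<delta>\<close> need not be unique, nor is it guaranteed to exist.\<close>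

definition stepI :: "(real ^ 'n) set \<Rightarrow> (real ^ 'n) set \<Rightarrow> real \<Rightarrow> real \<Rightarrow> real \<Rightarrow> real \<Rightarrow> real
    \<Rightarrow> (real ^ 'n) set \<Rightarrow> (real ^ 'n) set \<Rightarrow> (real ^ 'n) set \<Rightarrow> (real ^ 'n) set \<Rightarrow> bool" where
  "stepI \<Omega> D3 \<gamma>LV \<gamma>SL \<gamma>SV V0 \<delta>t D1 D2 D1' D2' \<longleftrightarrow>
     (\<exists>\<delta>. D1' = {x \<in> \<Omega>. phi1 D3 \<gamma>LV \<gamma>SL \<delta>t D2 x < phi2 D3 \<gamma>LV \<gamma>SV \<delta>t D1 x + \<delta>}
          \<and> measure lebesgue D1' = V0)
     \<and> D2' = \<Omega> - D1'"

definition stepII :: "(real ^ 'n) set \<Rightarrow> (real ^ 'n) set \<Rightarrow> real \<Rightarrow> real \<Rightarrow> real \<Rightarrow> real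
    \<Rightarrow> (real ^ 'n) set \<Rightarrow> (real ^ 'n) set \<Rightarrow> (real ^ 'n) set \<Rightarrow> (real ^ 'n) set \<Rightarrow> bool" where
  "stepII \<Omega> D3 \<gamma>LV \<theta>Y V0 \<delta>t D1 D2 D1' D2' \<longleftrightarrow>
     (\<exists>\<delta>. D1' = {x \<in> \<Omega>. phi D3 \<gamma>LV \<theta>Y \<delta>t D1 D2 x < \<delta>} \<and> measure lebesgue D1' = V0)
     \<and> D2' = \<Omega> - D1'"

text \<open>A run performing \<open>N\<close> iterations (\<open>N = \<infinity>\<close> allowed), so that exactly the iterates \<open>k \<le> N\<close>
  are generated. The stopping criterion only determines \<open>N\<close>; leaving \<open>N\<close> arbitrary covers
  every tolerance.\<close>

definition algorithmI :: "(real ^ 'n) set \<Rightarrow> (real ^ 'n) set \<Rightarrow> real \<Rightarrow> real \<Rightarrow> real \<Rightarrow> real \<Rightarrow> real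
    \<Rightarrow> enat \<Rightarrow> (nat \<Rightarrow> (real ^ 'n) set) \<Rightarrow> (nat \<Rightarrow> (real ^ 'n) set) \<Rightarrow> bool" where
  "algorithmI \<Omega> D3 \<gamma>LV \<gamma>SL \<gamma>SV V0 \<delta>t N D1 D2 \<longleftrightarrow>
     initial_partition \<Omega> V0 (D1 0) (D2 0) \<and>
     (\<forall>k. enat (Suc k) \<le> N \<longrightarrow>
        stepI \<Omega> D3 \<gamma>LV \<gamma>SL \<gamma>SV V0 \<delta>t (D1 k) (D2 k) (D1 (Suc k)) (D2 (Suc k)))"

definition algorithmII :: "(real ^ 'n) set \<Rightarrow> (real ^ 'n) set \<Rightarrow> real \<Rightarrow> real \<Rightarrow> real \<Rightarrow> real
    \<Rightarrow> enat \<Rightarrow> (nat \<Rightarrow> (real ^ 'n) set) \<Rightarrow> (nat \<Rightarrow> (real ^ 'n) set) \<Rightarrow> bool" where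
  "algorithmII \<Omega> D3 \<gamma>LV \<theta>Y V0 \<delta>t N D1 D2 \<longleftrightarrow>
     initial_partition \<Omega> V0 (D1 0) (D2 0) \<and>
     (\<forall>k. enat (Suc k) \<le> N \<longrightarrow>
        stepII \<Omega> D3 \<gamma>LV \<theta>Y V0 \<delta>t (D1 k) (D2 k) (D1 (Suc k)) (D2 (Suc k)))"

end

theory Submission
  imports Defs "HOL-Probability.Distributions"
begin

text \<open>As a function of \<open>indicator D1\<close>, with \<open>D2 = \<Omega> - D1\<close>, the energy is quadratic. Its quadratic part is
  \<open>- \<gamma>LV / sqrt \<delta>t\<close> times the form \<open>(f, g) \<mapsto> \<integral> f (G * g)\<close>, which is positive semidefinite because the
  semigroup property of the heat kernel gives \<open>\<integral> f (G\<^sub>t * f) = \<integral> (G\<^bsub>t/2\<^esub> * f)\<^sup>2\<close>. Hence the energy is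
  concave and lies below its linearisation at the current iterate. The next iterate is a sublevel
  set of the density of that linear functional, so it minimises the linearisation among all sets of
  volume \<open>V0\<close>.\<close>

no_notation Convolution.convolution (infix \<open>\<star>\<close> 50)

section \<open>The heat kernel: bounds, unit mass, semigroup property\<close>

lemma heat_kernel_nonneg: "0 \<le> heat_kernel t x"
  by (simp add: heat_kernel_def)

lemma heat_kernel_minus: "heat_kernel t (- x) = heat_kernel t x"
  by (simp add: heat_kernel_def)

lemma heat_kernel_le:
  fixes x :: "real ^ 'n"
  assumes "t > 0"
  shows "heat_kernel t x \<le> 1 / (4 * pi * t) powr (real CARD('n) / 2)"
proof -
  have "exp (- (norm x)\<^sup>2 / (4 * t)) \<le> 1"
    using assms by simp
  then show ?thesis
    unfolding heat_kernel_def by (intro mult_left_le) auto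
qed

lemma borel_measurable_heat_kernel [measurable]:
  "heat_kernel t \<in> borel_measurable borel"
  unfolding heat_kernel_def by measurable

text \<open>A centred normal density of variance \<open>2 * t\<close> has prefactor
  \<open>1 / sqrt (4 * pi * t)\<close> and exponent \<open>- s^2 / (4 * t)\<close>, so the exponents
  add up to the squared norm. This reduces the total mass to one-dimensional integrals.\<close>

lemma heat_kernel_eq_prod_normal_density:
  fixes x :: "real ^ 'n"
  assumes "t > 0"
  shows "heat_kernel t x = (\<Prod>b\<in>Basis. normal_density 0 (sqrt (2 * t)) (x \<bullet> b))"
proof -
  have "(\<Prod>b\<in>Basis. normal_density 0 (sqrt (2 * t)) (x \<bullet> b)) =
      (1 / sqrt (4 * pi * t)) ^ CARD('n) * exp (\<Sum>b\<in>Basis. - (x \<bullet> b)\<^sup>2 / (4 * t))"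
    using assms by (simp add: normal_density_def prod.distrib exp_sum prod_dividef algebra_simps power_divide)
  also have "(\<Sum>b\<in>Basis. - (x \<bullet> b)\<^sup>2 / (4 * t)) = - (norm x)\<^sup>2 / (4 * t)"
    unfolding power2_norm_eq_inner euclidean_inner[of x x]
    by (simp add: power2_eq_square sum_negf sum_divide_distrib)
  also have "(1 / sqrt (4 * pi * t)) ^ CARD('n) = 1 / (4 * pi * t) powr (real CARD('n) / 2)"
  proof -
    have "sqrt (4 * pi * t) ^ CARD('n) = ((4 * pi * t) powr (1 / 2)) powr real CARD('n)"
      using assms by (simp add: powr_half_sqrt powr_realpow)
    also have "\<dots> = (4 * pi * t) powr (real CARD('n) / 2)"
      by (simp only: powr_powr) simp
    finally show ?thesis by (simp add: power_divide)
  qed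
  finally show ?thesis by (simp add: heat_kernel_def)
qed

lemma has_bochner_integral_heat_kernel:
  assumes "t > 0"
  shows "has_bochner_integral lborel (heat_kernel t :: real ^ 'n \<Rightarrow> real) 1"
proof (rule has_bochner_integral_nn_integral)
  have "(\<integral>\<^sup>+x. ennreal (heat_kernel t x) \<partial>(lborel :: (real ^ 'n) measure)) =
      (\<integral>\<^sup>+x. (\<Prod>b\<in>Basis. ennreal (normal_density 0 (sqrt (2 * t)) (x \<bullet> b)))
        \<partial>(lborel :: (real ^ 'n) measure))"
    using assms by (simp add: heat_kernel_eq_prod_normal_density prod_ennreal)
  also have "\<dots> = (\<Prod>b\<in>(Basis :: (real ^ 'n) set).
      \<integral>\<^sup>+x. ennreal (normal_density 0 (sqrt (2 * t)) x) \<partial>lborel)"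
    by (rule nn_integral_lborel_prod) auto
  also have "\<dots> = ennreal 1"
    using assms by (simp add: nn_integral_eq_integral)
  finally show "(\<integral>\<^sup>+x. ennreal (heat_kernel t x) \<partial>(lborel :: (real ^ 'n) measure)) = ennreal 1" .
qed (auto simp: heat_kernel_nonneg)

text \<open>Translation invariance holds for \<open>lborel\<close>; the result passes to its
  completion \<open>lebesgue\<close> because the integrand is Borel.\<close>

lemma has_bochner_integral_heat_kernel_translate:
  fixes m :: "real ^ 'n"
  assumes "t > 0"
  shows "has_bochner_integral lebesgue (\<lambda>z. heat_kernel t (z - m)) 1"
proof -
  have "has_bochner_integral (distr lborel borel ((+) (- m))) (heat_kernel t) 1"
    using has_bochner_integral_heat_kernel[OF assms] by (simp add: lborel_distr_plus)
  then have "has_bochner_integral lborel (\<lambda>z. heat_kernel t (z - m)) 1"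
    by (simp add: has_bochner_integral_iff integrable_distr_eq integral_distr)
  moreover have "(\<lambda>z. heat_kernel t (z - m)) \<in> borel_measurable lborel"
    by measurable
  ultimately show ?thesis
    by (simp add: has_bochner_integral_iff integrable_completion integral_completion)
qed

text \<open>Completing the square in \<open>z\<close>: the product of two Gaussians centred at
  \<open>x\<close> and \<open>y\<close> is a Gaussian centred at their midpoint, with time
  \<open>t / 4\<close>, times a factor free of \<open>z\<close>.\<close>

lemma heat_kernel_half_mult:
  fixes x y z :: "real ^ 'n"
  assumes "t > 0"
  shows "heat_kernel (t / 2) (x - z) * heat_kernel (t / 2) (y - z) =
    heat_kernel t (x - y) * heat_kernel (t / 4) (z - (1 / 2) *\<^sub>R (x + y))"
proof -
  let ?n = "real CARD('n) / 2"
  \<comment> \<open>The parallelogram law for \<open>x - z\<close> and \<open>y - z\<close>, solved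
    for one term so that it can serve as a rewrite rule.\<close>
  have parallelogram: "(norm (x - z))\<^sup>2 =
      2 * (norm (z - (1 / 2) *\<^sub>R (x + y)))\<^sup>2 + (norm (x - y))\<^sup>2 / 2 - (norm (y - z))\<^sup>2"
    unfolding power2_norm_eq_inner
    by (simp add: inner_diff inner_add inner_commute field_simps)
  have "- (norm (x - z))\<^sup>2 / (4 * (t / 2)) + - (norm (y - z))\<^sup>2 / (4 * (t / 2)) =
      - (norm (x - y))\<^sup>2 / (4 * t) + - (norm (z - (1 / 2) *\<^sub>R (x + y)))\<^sup>2 / (4 * (t / 4))"
    unfolding parallelogram using assms by (simp add: field_simps)
  then have e: "exp (- (norm (x - z))\<^sup>2 / (4 * (t / 2))) * exp (- (norm (y - z))\<^sup>2 / (4 * (t / 2))) =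
      exp (- (norm (x - y))\<^sup>2 / (4 * t)) *
      exp (- (norm (z - (1 / 2) *\<^sub>R (x + y)))\<^sup>2 / (4 * (t / 4)))"
    by (simp only: exp_add[symmetric])
  \<comment> \<open>The normalising constants agree because
    \<open>(t / 2) * (t / 2) = t * (t / 4)\<close>.\<close>
  have c: "(4 * pi * (t / 2)) powr ?n * (4 * pi * (t / 2)) powr ?n =
      (4 * pi * t) powr ?n * (4 * pi * (t / 4)) powr ?n"
    using assms by (simp add: powr_mult[symmetric] algebra_simps)
  have "heat_kernel (t / 2) (x - z) * heat_kernel (t / 2) (y - z) =
      1 / ((4 * pi * (t / 2)) powr ?n * (4 * pi * (t / 2)) powr ?n) *
      (exp (- (norm (x - z))\<^sup>2 / (4 * (t / 2))) * exp (- (norm (y - z))\<^sup>2 / (4 * (t / 2))))"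
    unfolding heat_kernel_def by (simp only: times_divide_eq_left times_divide_eq_right mult_1 divide_divide_eq_left)
  also have "\<dots> = heat_kernel t (x - y) * heat_kernel (t / 4) (z - (1 / 2) *\<^sub>R (x + y))"
    unfolding e c heat_kernel_def by simp
  finally show ?thesis .
qed

text \<open>The midpoint Gaussian integrates to 1, leaving the factor free of \<open>z\<close>. Both
  kernels are centred at \<open>z\<close>, the form in which a square appears later.\<close>

lemma has_bochner_integral_heat_semigroup:
  fixes x y :: "real ^ 'n"
  assumes "t > 0"
  shows "has_bochner_integral lebesgue
    (\<lambda>z. heat_kernel (t / 2) (x - z) * heat_kernel (t / 2) (y - z)) (heat_kernel t (x - y))"
  unfolding heat_kernel_half_mult[OF assms]
  using has_bochner_integral_mult_right[OF has_bochner_integral_heat_kernel_translate[of "t / 4"],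
      of "heat_kernel t (x - y)"] assms
  by auto

section \<open>Measurability and integrability over products of \<open>lebesgue\<close>\<close>

text \<open>Completion keeps the measure of the old measurable sets, so the same countable cover
  works. This makes Fubini available for \<open>lebesgue\<close>.\<close>

lemma sigma_finite_completion:
  assumes "sigma_finite_measure M"
  shows "sigma_finite_measure (completion M)"
proof -
  obtain A where "countable A" "A \<subseteq> sets M" "\<Union>A = space M" "\<forall>a\<in>A. emeasure M a \<noteq> \<infinity>"
    using sigma_finite_measure.sigma_finite_countable[OF assms] by blast
  then show ?thesis
    by (intro sigma_finite_measure.intro exI[of _ A]) auto
qed

interpretation lebesgue: sigma_finite_measure lebesgue
  by (rule sigma_finite_completion[OF sigma_finite_lborel])

interpretation lebesgue_pair: pair_sigma_finite lebesgue lebesgue ..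

text \<open>The projections are also measurable into the coarser Borel algebra, so Borel functions
  such as the kernel can be composed with differences of coordinates.\<close>

lemma borel_measurable_fst_lebesgue [measurable]: "fst \<in> borel_measurable (lebesgue \<Otimes>\<^sub>M M)"
  by (rule measurable_compose[OF measurable_fst]) (auto intro: measurable_completion)

lemma borel_measurable_snd_lebesgue [measurable]: "snd \<in> borel_measurable (M \<Otimes>\<^sub>M lebesgue)"
  by (rule measurable_compose[OF measurable_snd]) (auto intro: measurable_completion)

lemma borel_measurable_lebesgue_ident [measurable]: "(\<lambda>x. x) \<in> borel_measurable lebesgue"
  by (intro measurable_completion) simp

lemma borel_measurable_convolution_heat_kernel [measurable]:
  assumes [measurable]: "g \<in> borel_measurable lebesgue"
  shows "(heat_kernel t \<star> g) \<in> borel_measurable lebesgue"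
  unfolding Defs.convolution_def[abs_def] by measurable

lemma (in pair_sigma_finite) integrable_fst_mult_snd:
  fixes f g :: "_ \<Rightarrow> real"
  assumes "integrable M1 f" "integrable M2 g"
  shows "integrable (M1 \<Otimes>\<^sub>M M2) (\<lambda>p. f (fst p) * g (snd p))"
proof (rule Fubini_integrable)
  note [measurable] = borel_measurable_integrable[OF assms(1)] borel_measurable_integrable[OF assms(2)]
  show "(\<lambda>p. f (fst p) * g (snd p)) \<in> borel_measurable (M1 \<Otimes>\<^sub>M M2)" by measurable
qed (use assms in \<open>auto simp: abs_mult\<close>)

lemma integrable_mult_heat_kernel:
  fixes g :: "real ^ 'n \<Rightarrow> real"
  assumes "t > 0" "integrable lebesgue g"
  shows "integrable lebesgue (\<lambda>y. heat_kernel t (x - y) * g y)"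
proof (rule Bochner_Integration.integrable_bound)
  note [measurable] = borel_measurable_integrable[OF assms(2)]
  let ?c = "1 / (4 * pi * t) powr (real CARD('n) / 2)"
  show "integrable lebesgue (\<lambda>y. ?c * g y)"
    using assms by (intro integrable_mult_right)
  show "(\<lambda>y. heat_kernel t (x - y) * g y) \<in> borel_measurable lebesgue" by measurable
  show "AE y in lebesgue. norm (heat_kernel t (x - y) * g y) \<le> norm (?c * g y)"
    unfolding norm_mult using heat_kernel_le[OF assms(1), where 'n = 'n]
    by (intro AE_I2 mult_right_mono) (auto simp: heat_kernel_nonneg)
qed

text \<open>The kernel is bounded by its value at the origin, so a multiple of the integrable
  function \<open>f x * g y\<close> dominates. This justifies the later uses of Fubini.\<close>

lemma integrable_pair_heat_kernel:
  fixes f g :: "real ^ 'n \<Rightarrow> real"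
  assumes "t > 0" "integrable lebesgue f" "integrable lebesgue g"
  shows "integrable (lebesgue \<Otimes>\<^sub>M lebesgue) (\<lambda>(x, y). f x * (heat_kernel t (x - y) * g y))"
proof (rule Bochner_Integration.integrable_bound)
  note [measurable] = borel_measurable_integrable[OF assms(2)] borel_measurable_integrable[OF assms(3)]
  let ?c = "1 / (4 * pi * t) powr (real CARD('n) / 2)"
  show "integrable (lebesgue \<Otimes>\<^sub>M lebesgue) (\<lambda>p. ?c * (f (fst p) * g (snd p)))"
    using assms by (intro integrable_mult_right lebesgue_pair.integrable_fst_mult_snd)
  show "(\<lambda>(x, y). f x * (heat_kernel t (x - y) * g y)) \<in> borel_measurable (lebesgue \<Otimes>\<^sub>M lebesgue)"
    by measurable
  have "\<bar>f x\<bar> * (heat_kernel t (x - y) * \<bar>g y\<bar>) \<le> ?c * (\<bar>f x\<bar> * \<bar>g y\<bar>)" for x y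
    using mult_right_mono[OF heat_kernel_le[OF assms(1)], of "\<bar>f x\<bar> * \<bar>g y\<bar>" "x - y"]
    by (simp add: mult_ac)
  then show "AE p in lebesgue \<Otimes>\<^sub>M lebesgue.
      norm (case p of (x, y) \<Rightarrow> f x * (heat_kernel t (x - y) * g y)) \<le> norm (?c * (f (fst p) * g (snd p)))"
    by (intro AE_I2) (auto simp: abs_mult heat_kernel_nonneg)
qed

section \<open>Linearity, symmetry and positivity of the heat form\<close>

lemma convolution_add:
  assumes "t > 0" "integrable lebesgue f" "integrable lebesgue g"
  shows "(heat_kernel t \<star> (\<lambda>y. f y + g y)) x = (heat_kernel t \<star> f) x + (heat_kernel t \<star> g) x"
  unfolding Defs.convolution_def
  by (simp add: distrib_left integrable_mult_heat_kernel assms)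

lemma convolution_diff:
  assumes "t > 0" "integrable lebesgue f" "integrable lebesgue g"
  shows "(heat_kernel t \<star> (\<lambda>y. f y - g y)) x = (heat_kernel t \<star> f) x - (heat_kernel t \<star> g) x"
  unfolding Defs.convolution_def
  by (simp add: right_diff_distrib integrable_mult_heat_kernel assms)

lemma convolution_cmult:
  "(heat_kernel t \<star> (\<lambda>y. c * g y)) x = c * (heat_kernel t \<star> g) x"
  unfolding Defs.convolution_def
  by (simp add: mult.left_commute[of _ c])

text \<open>The bilinear form of the heat semigroup at time \<open>t\<close>; for phases inside
  \<Omega>, each term of the energy is a multiple of it.\<close>

definition heat_form :: "real \<Rightarrow> (real ^ 'n \<Rightarrow> real) \<Rightarrow> (real ^ 'n \<Rightarrow> real) \<Rightarrow> real" where
  "heat_form t f g = (LINT x|lebesgue. f x * (heat_kernel t \<star> g) x)"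

lemma integrable_heat_form:
  assumes "t > 0" "integrable lebesgue f" "integrable lebesgue g"
  shows "integrable lebesgue (\<lambda>x. f x * (heat_kernel t \<star> g) x)"
  using lebesgue_pair.integrable_fst[OF integrable_pair_heat_kernel[OF assms]]
  by (simp add: Defs.convolution_def)

text \<open>Fubini, together with evenness of the kernel.\<close>

lemma heat_form_commute:
  assumes "t > 0" "integrable lebesgue f" "integrable lebesgue g"
  shows "heat_form t f g = heat_form t g f"
proof -
  have "heat_form t f g = (LINT x|lebesgue. LINT y|lebesgue. f x * (heat_kernel t (x - y) * g y))"
    by (simp add: heat_form_def Defs.convolution_def)
  also have "\<dots> = (LINT y|lebesgue. LINT x|lebesgue. f x * (heat_kernel t (x - y) * g y))"
    using lebesgue_pair.Fubini_integral[OF integrable_pair_heat_kernel[OF assms]] by simp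
  also have "\<dots> = (LINT y|lebesgue. LINT x|lebesgue. g y * (heat_kernel t (y - x) * f x))"
  proof -
    have "f x * (heat_kernel t (x - y) * g y) = g y * (heat_kernel t (y - x) * f x)" for x y
      using heat_kernel_minus[of t "x - y"] by simp
    then show ?thesis by (simp only:)
  qed
  also have "\<dots> = heat_form t g f"
    by (simp add: heat_form_def Defs.convolution_def)
  finally show ?thesis .
qed

lemma heat_form_diff_left:
  assumes "t > 0" "integrable lebesgue f" "integrable lebesgue g" "integrable lebesgue h"
  shows "heat_form t (\<lambda>x. f x - g x) h = heat_form t f h - heat_form t g h"
  using assms by (simp add: heat_form_def left_diff_distrib integrable_heat_form)

lemma heat_form_diff_right:
  assumes "t > 0" "integrable lebesgue f" "integrable lebesgue g" "integrable lebesgue h"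
  shows "heat_form t h (\<lambda>x. f x - g x) = heat_form t h f - heat_form t h g"
  using assms by (simp add: heat_form_commute[of t h] heat_form_diff_left)

lemma heat_form_add_right:
  assumes "t > 0" "integrable lebesgue f" "integrable lebesgue g" "integrable lebesgue h"
  shows "heat_form t h (\<lambda>x. f x + g x) = heat_form t h f + heat_form t h g"
  using assms by (simp add: heat_form_def convolution_add distrib_left integrable_heat_form)

lemma heat_form_cmult_right: "heat_form t h (\<lambda>x. c * f x) = c * heat_form t h f"
  by (simp add: heat_form_def convolution_cmult mult.left_commute[of _ c])

text \<open>The semigroup property writes \<open>heat_kernel t (x - y)\<close> as an integral over
  \<open>z\<close>. Once \<open>z\<close> is moved outermost, the double integral over
  \<open>x\<close> and \<open>y\<close> factors into a square.\<close>

lemma heat_form_self_eq_integral_square: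
  assumes t: "t > 0" and f: "integrable lebesgue f"
  shows "heat_form t f f = (LINT z|lebesgue. ((heat_kernel (t / 2) \<star> f) z)\<^sup>2)"
proof -
  note [measurable] = borel_measurable_integrable[OF f]
  interpret triple: pair_sigma_finite "lebesgue \<Otimes>\<^sub>M lebesgue" lebesgue ..
  let ?F = "\<lambda>p z. f (fst p) * f (snd p) *
    (heat_kernel (t / 2) (fst p - z) * heat_kernel (t / 2) (snd p - z))"
  have sg: "integrable lebesgue (\<lambda>z. heat_kernel (t / 2) (x - z) * heat_kernel (t / 2) (y - z))"
    "(LINT z|lebesgue. heat_kernel (t / 2) (x - z) * heat_kernel (t / 2) (y - z)) = heat_kernel t (x - y)"
    for x y :: "real ^ 'a"
    using has_bochner_integral_heat_semigroup[OF t, of x y] by (simp_all add: has_bochner_integral_iff)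
  \<comment> \<open>Integrating the absolute value over \<open>z\<close> first works because the
    kernels are nonnegative: the semigroup property collapses it to the integrable pair function
    built from \<open>\<bar>f\<bar>\<close>.\<close>
  have int: "integrable ((lebesgue \<Otimes>\<^sub>M lebesgue) \<Otimes>\<^sub>M lebesgue) (\<lambda>(p, z). ?F p z)"
  proof (rule triple.Fubini_integrable)
    show "(\<lambda>(p, z). ?F p z) \<in> borel_measurable ((lebesgue \<Otimes>\<^sub>M lebesgue) \<Otimes>\<^sub>M lebesgue)"
      by measurable
    have "(LINT z|lebesgue. norm (case (p, z) of (p, z) \<Rightarrow> ?F p z)) =
        \<bar>f (fst p)\<bar> * (heat_kernel t (fst p - snd p) * \<bar>f (snd p)\<bar>)" for p
      by (simp add: abs_mult heat_kernel_nonneg sg)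
    then show "integrable (lebesgue \<Otimes>\<^sub>M lebesgue)
        (\<lambda>p. LINT z|lebesgue. norm (case (p, z) of (p, z) \<Rightarrow> ?F p z))"
      using integrable_pair_heat_kernel[OF t integrable_abs[OF f] integrable_abs[OF f]]
      by (simp add: case_prod_unfold)
    show "AE p in lebesgue \<Otimes>\<^sub>M lebesgue. integrable lebesgue (\<lambda>z. case (p, z) of (p, z) \<Rightarrow> ?F p z)"
      by (simp add: sg)
  qed
  have "heat_form t f f = (LINT x|lebesgue. LINT y|lebesgue. f x * (heat_kernel t (x - y) * f y))"
    by (simp add: heat_form_def Defs.convolution_def)
  also have "\<dots> = (LINT p|(lebesgue \<Otimes>\<^sub>M lebesgue). f (fst p) * (heat_kernel t (fst p - snd p) * f (snd p)))"
    using lebesgue_pair.integral_fst[OF integrable_pair_heat_kernel[OF t f f]]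
    by (simp add: case_prod_unfold)
  also have "\<dots> = (LINT p|(lebesgue \<Otimes>\<^sub>M lebesgue). LINT z|lebesgue. ?F p z)"
    by (simp add: sg mult_ac)
  also have "\<dots> = (LINT z|lebesgue. LINT p|(lebesgue \<Otimes>\<^sub>M lebesgue). ?F p z)"
    using triple.Fubini_integral[OF int] by simp
  also have "\<dots> = (LINT z|lebesgue. ((heat_kernel (t / 2) \<star> f) z)\<^sup>2)"
  proof (rule Bochner_Integration.integral_cong[OF refl])
    fix z :: "real ^ 'a"
    let ?g = "\<lambda>x. heat_kernel (t / 2) (z - x) * f x"
    have g: "integrable lebesgue ?g"
      using t f by (intro integrable_mult_heat_kernel) auto
    \<comment> \<open>Evenness reorders the arguments to match the convolution evaluated at
      \<open>z\<close>.\<close>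
    have "heat_kernel (t / 2) (x - z) = heat_kernel (t / 2) (z - x)" for x
      using heat_kernel_minus[of "t / 2" "x - z"] by simp
    then have "(LINT p|(lebesgue \<Otimes>\<^sub>M lebesgue). ?F p z) =
        (LINT p|(lebesgue \<Otimes>\<^sub>M lebesgue). ?g (fst p) * ?g (snd p))"
      by (simp add: mult_ac)
    also have "\<dots> = (LINT x|lebesgue. LINT y|lebesgue. ?g x * ?g y)"
      using lebesgue_pair.integral_fst'[OF lebesgue_pair.integrable_fst_mult_snd[OF g g]] by simp
    also have "\<dots> = ((heat_kernel (t / 2) \<star> f) z)\<^sup>2"
      by (simp only: integral_mult_right_zero integral_mult_left_zero Defs.convolution_def power2_eq_square)
    finally show "(LINT p|(lebesgue \<Otimes>\<^sub>M lebesgue). ?F p z) = ((heat_kernel (t / 2) \<star> f) z)\<^sup>2" .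
  qed
  finally show ?thesis .
qed

lemma heat_form_self_nonneg:
  assumes "t > 0" "integrable lebesgue f"
  shows "0 \<le> heat_form t f f"
  by (simp add: heat_form_self_eq_integral_square assms)

section \<open>Energy decrease under thresholding\<close>

text \<open>The bathtub principle: among subsets of \<Omega> of a given volume, a sublevel set of a
  potential minimises the integral of that potential.\<close>

lemma heat_form_threshold_le_0:
  assumes t: "t > 0" and A: "A \<in> lmeasurable" and A': "A' \<in> lmeasurable"
    and vol: "measure lebesgue A = measure lebesgue A'"
    and h: "integrable lebesgue h"
    and sub: "A \<subseteq> \<Omega>" and thr: "A' = {x \<in> \<Omega>. (heat_kernel t \<star> h) x < \<delta>}"
  shows "heat_form t (\<lambda>x. indicator A' x - indicator A x) h \<le> 0"
proof -
  let ?w = "\<lambda>x. indicator A' x - indicator A x :: real"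
  have w: "integrable lebesgue ?w"
    using A A' by (intro Bochner_Integration.integrable_diff) (auto simp: fmeasurable_def)
  have 0: "(LINT x|lebesgue. ?w x) = 0"
    using A A' vol by (subst Bochner_Integration.integral_diff) (auto simp: fmeasurable_def)
  \<comment> \<open>Equal volumes give \<open>?w\<close> mean zero, so the level \<delta> can be
    subtracted from the potential at no cost.\<close>
  have "heat_form t ?w h = (LINT x|lebesgue. ?w x * (heat_kernel t \<star> h) x) - (LINT x|lebesgue. ?w x * \<delta>)"
    by (simp only: integral_mult_left_zero 0 heat_form_def)
  also have "\<dots> = (LINT x|lebesgue. ?w x * (heat_kernel t \<star> h) x - ?w x * \<delta>)"
    using integrable_heat_form[OF t w h] w
    by (intro Bochner_Integration.integral_diff[symmetric]) auto
  also have "\<dots> \<le> 0"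
  proof -
    \<comment> \<open>Pointwise signs: on \<open>A' - A\<close> the weight is 1 and the potential is
      below \<delta>; on \<open>A - A'\<close>, which lies in \<Omega>, the weight is -1 and the
      potential is at least \<delta>.\<close>
    have "0 \<le> (LINT x|lebesgue. - (?w x * (heat_kernel t \<star> h) x - ?w x * \<delta>))"
      using sub by (intro integral_nonneg_AE AE_I2) (auto simp: thr indicator_def)
    then show ?thesis by (simp only: Bochner_Integration.integral_minus neg_0_le_iff_le)
  qed
  finally show ?thesis .
qed

text \<open>For phases contained in \<Omega>, neither the extension by zero nor the restriction to
  \<open>\<Omega> \<union> D3\<close> changes an integrand.\<close>

lemma energy_indicator_eq:
  assumes "A \<subseteq> \<Omega>" "B \<subseteq> \<Omega>"
  shows "energy \<Omega> D3 \<gamma>LV \<gamma>SL \<gamma>SV \<delta>t (indicator A) (indicator B) =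
    (\<gamma>LV * heat_form \<delta>t (indicator A) (indicator B) + \<gamma>SL * heat_form \<delta>t (indicator A) (indicator D3)
      + \<gamma>SV * heat_form \<delta>t (indicator B) (indicator D3)) / sqrt \<delta>t"
proof -
  have z: "zero_ext \<Omega> (indicator C) = indicator C" if "C \<subseteq> \<Omega>" for C :: "(real ^ 'a) set"
    using that by (auto simp: zero_ext_def indicator_def fun_eq_iff)
  have i: "(LINT x:(\<Omega> \<union> D3)|lebesgue. indicator C x * (heat_kernel \<delta>t \<star> g) x) =
      heat_form \<delta>t (indicator C) g" if "C \<subseteq> \<Omega>" for C :: "(real ^ 'a) set" and g
    unfolding set_lebesgue_integral_def heat_form_def using that
    by (intro Bochner_Integration.integral_cong) (auto simp: indicator_def)
  show ?thesis
    using assms by (simp add: energy_def z i add_divide_distrib)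
qed

text \<open>Up to the factor \<open>sqrt \<delta>t\<close>,
  \<open>heat_kernel \<delta>t \<star> h\<close> is the density of the derivative of the energy at
  \<open>A\<close>. The bathtub principle controls the linear part of the energy change, positivity
  of the heat form the quadratic part.\<close>

lemma energy_threshold_le:
  fixes \<Omega> D3 A A' :: "(real ^ 'n) set" and \<gamma>LV \<gamma>SL \<gamma>SV \<delta>t \<delta> :: real
  defines "h \<equiv> \<lambda>y. \<gamma>LV * (indicator (\<Omega> - A) y - indicator A y) + (\<gamma>SL - \<gamma>SV) * indicator D3 y"
  assumes t: "\<delta>t > 0" and \<gamma>: "\<gamma>LV \<ge> 0"
    and \<Omega>: "\<Omega> \<in> lmeasurable" and D3: "D3 \<in> lmeasurable"
    and A: "A \<in> lmeasurable" and A': "A' \<in> lmeasurable" and sub: "A \<subseteq> \<Omega>"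
    and vol: "measure lebesgue A = measure lebesgue A'"
    and thr: "A' = {x \<in> \<Omega>. (heat_kernel \<delta>t \<star> h) x < \<delta>}"
  shows "energy \<Omega> D3 \<gamma>LV \<gamma>SL \<gamma>SV \<delta>t (indicator A') (indicator (\<Omega> - A'))
    \<le> energy \<Omega> D3 \<gamma>LV \<gamma>SL \<gamma>SV \<delta>t (indicator A) (indicator (\<Omega> - A))"
proof -
  define a a' d o' :: "real ^ 'n \<Rightarrow> real"
    where "a = indicator A" and "a' = indicator A'" and "d = indicator D3" and "o' = indicator \<Omega>"
  note defs = a_def a'_def d_def o'_def
  have int: "integrable lebesgue a" "integrable lebesgue a'" "integrable lebesgue d" "integrable lebesgue o'"
    using A A' D3 \<Omega> by (auto simp: defs fmeasurable_def)
  have sub': "A' \<subseteq> \<Omega>" using thr by auto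
  have compl: "indicator (\<Omega> - A) = (\<lambda>x. o' x - a x)" "indicator (\<Omega> - A') = (\<lambda>x. o' x - a' x)"
    using sub sub' by (auto simp: defs indicator_def fun_eq_iff)
  have h: "h = (\<lambda>y. \<gamma>LV * (o' y - a y - a y) + (\<gamma>SL - \<gamma>SV) * d y)"
    by (simp add: h_def compl) (simp add: defs)
  note lin = heat_form_diff_left heat_form_diff_right heat_form_add_right heat_form_cmult_right
  have "heat_form \<delta>t (\<lambda>x. a' x - a x) h \<le> 0"
    unfolding a_def a'_def
    by (rule heat_form_threshold_le_0[OF t A A' vol _ sub thr]) (simp add: h int)
  moreover have "0 \<le> \<gamma>LV * heat_form \<delta>t (\<lambda>x. a' x - a x) (\<lambda>x. a' x - a x)"
    using \<gamma> by (intro mult_nonneg_nonneg heat_form_self_nonneg t) (auto simp: int)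
  ultimately have "heat_form \<delta>t (\<lambda>x. a' x - a x) h
      - \<gamma>LV * heat_form \<delta>t (\<lambda>x. a' x - a x) (\<lambda>x. a' x - a x) \<le> 0" by linarith
  \<comment> \<open>The exact second-order expansion of \<open>sqrt \<delta>t\<close> times the
    energy around \<open>a\<close>; there is no remainder because the energy is quadratic. Symmetry
    of the form merges the cross terms in \<open>a\<close> and \<open>a'\<close>.\<close>
  also have "heat_form \<delta>t (\<lambda>x. a' x - a x) h
      - \<gamma>LV * heat_form \<delta>t (\<lambda>x. a' x - a x) (\<lambda>x. a' x - a x) =
      (\<gamma>LV * heat_form \<delta>t a' (\<lambda>x. o' x - a' x) + \<gamma>SL * heat_form \<delta>t a' d
        + \<gamma>SV * heat_form \<delta>t (\<lambda>x. o' x - a' x) d)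
      - (\<gamma>LV * heat_form \<delta>t a (\<lambda>x. o' x - a x) + \<gamma>SL * heat_form \<delta>t a d
        + \<gamma>SV * heat_form \<delta>t (\<lambda>x. o' x - a x) d)"
    using heat_form_commute[OF t int(1,2)] by (simp add: h lin int t) (simp add: algebra_simps)
  finally show ?thesis
    unfolding energy_indicator_eq[OF sub Diff_subset] energy_indicator_eq[OF sub' Diff_subset]
    unfolding compl defs[symmetric]
    using t by (intro divide_right_mono) auto
qed

section \<open>Both algorithms threshold the same potential\<close>

text \<open>By linearity the potential is \<open>sqrt \<delta>t\<close> times the difference of
  \<open>phi1\<close> and \<open>phi2\<close>, so the level is rescaled by the positive factor
  \<open>sqrt \<delta>t\<close>.\<close>

lemma stepI_threshold:
  assumes step: "stepI \<Omega> D3 \<gamma>LV \<gamma>SL \<gamma>SV V0 \<delta>t A B A' B'" and t: "\<delta>t > 0"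
    and "D3 \<in> lmeasurable" "A \<in> lmeasurable" "B \<in> lmeasurable"
  obtains \<delta> where "A' = {x \<in> \<Omega>. (heat_kernel \<delta>t \<star>
    (\<lambda>y. \<gamma>LV * (indicator B y - indicator A y) + (\<gamma>SL - \<gamma>SV) * indicator D3 y)) x < \<delta>}"
proof -
  have int: "integrable lebesgue (indicator C :: _ \<Rightarrow> real)" if "C \<in> {D3, A, B}" for C
    using that assms by (auto simp: fmeasurable_def)
  have "(heat_kernel \<delta>t \<star> (\<lambda>y. \<gamma>LV * (indicator B y - indicator A y) + (\<gamma>SL - \<gamma>SV) * indicator D3 y)) x =
      sqrt \<delta>t * (phi1 D3 \<gamma>LV \<gamma>SL \<delta>t B x - phi2 D3 \<gamma>LV \<gamma>SV \<delta>t A x)" for x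
  proof -
    have "sqrt \<delta>t * (phi1 D3 \<gamma>LV \<gamma>SL \<delta>t B x - phi2 D3 \<gamma>LV \<gamma>SV \<delta>t A x) =
        (heat_kernel \<delta>t \<star> (\<lambda>y. \<gamma>LV * indicator B y + \<gamma>SL * indicator D3 y)) x -
        (heat_kernel \<delta>t \<star> (\<lambda>y. \<gamma>LV * indicator A y + \<gamma>SV * indicator D3 y)) x"
      using t by (simp add: phi1_def phi2_def right_diff_distrib)
    then show ?thesis
      using t by (simp add: convolution_add convolution_cmult convolution_diff int algebra_simps)
  qed
  then have "(heat_kernel \<delta>t \<star> (\<lambda>y. \<gamma>LV * (indicator B y - indicator A y) + (\<gamma>SL - \<gamma>SV) * indicator D3 y)) x
      < sqrt \<delta>t * \<delta> \<longleftrightarrow> phi1 D3 \<gamma>LV \<gamma>SL \<delta>t B x < phi2 D3 \<gamma>LV \<gamma>SV \<delta>t A x + \<delta>" for x \<delta>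
    using t by (simp only: mult_less_cancel_left_pos real_sqrt_gt_0_iff) linarith
  moreover obtain \<delta> where "A' = {x \<in> \<Omega>. phi1 D3 \<gamma>LV \<gamma>SL \<delta>t B x < phi2 D3 \<gamma>LV \<gamma>SV \<delta>t A x + \<delta>}"
    using step by (auto simp: stepI_def)
  ultimately have "A' = {x \<in> \<Omega>. (heat_kernel \<delta>t \<star>
      (\<lambda>y. \<gamma>LV * (indicator B y - indicator A y) + (\<gamma>SL - \<gamma>SV) * indicator D3 y)) x < sqrt \<delta>t * \<delta>}"
    by simp
  then show ?thesis by (rule that)
qed

text \<open>Young's law turns the coefficient \<open>- \<gamma>LV * cos \<theta>Y\<close> of the
  solid into \<open>\<gamma>SL - \<gamma>SV\<close>, the coefficient found for the first
  algorithm.\<close>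

lemma stepII_threshold:
  assumes step: "stepII \<Omega> D3 \<gamma>LV \<theta>Y V0 \<delta>t A B A' B'" and t: "\<delta>t > 0"
    and young: "\<gamma>LV * cos \<theta>Y = \<gamma>SV - \<gamma>SL"
  obtains \<delta> where "A' = {x \<in> \<Omega>. (heat_kernel \<delta>t \<star>
    (\<lambda>y. \<gamma>LV * (indicator B y - indicator A y) + (\<gamma>SL - \<gamma>SV) * indicator D3 y)) x < \<delta>}"
proof -
  have eq: "\<gamma>LV * (indicator B y - indicator A y) + (\<gamma>SL - \<gamma>SV) * indicator D3 y =
      \<gamma>LV * (indicator B y - indicator A y - cos \<theta>Y * indicator D3 y)" for y :: "real ^ 'a"
  proof -
    have "\<gamma>SV = \<gamma>SL + \<gamma>LV * cos \<theta>Y" using young by simp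
    then show ?thesis by (simp add: algebra_simps)
  qed
  have "(heat_kernel \<delta>t \<star> (\<lambda>y. \<gamma>LV * (indicator B y - indicator A y) + (\<gamma>SL - \<gamma>SV) * indicator D3 y)) x =
      sqrt \<delta>t * phi D3 \<gamma>LV \<theta>Y \<delta>t A B x" for x
    using t by (simp only: eq convolution_cmult phi_def) simp
  moreover obtain \<delta> where "A' = {x \<in> \<Omega>. phi D3 \<gamma>LV \<theta>Y \<delta>t A B x < \<delta>}"
    using step by (auto simp: stepII_def)
  ultimately have "A' = {x \<in> \<Omega>. (heat_kernel \<delta>t \<star>
      (\<lambda>y. \<gamma>LV * (indicator B y - indicator A y) + (\<gamma>SL - \<gamma>SV) * indicator D3 y)) x < sqrt \<delta>t * \<delta>}"
    using t by simp
  then show ?thesis by (rule that)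
qed

theorem theorem3p1:
  fixes \<Omega> D3 :: "(real ^ 'n) set"
    and \<gamma>LV \<gamma>SL \<gamma>SV \<theta>Y V0 \<delta>t :: real
    and N :: enat
    and D1 D2 :: "nat \<Rightarrow> (real ^ 'n) set"
    and k :: nat
  assumes "CARD('n) = 2 \<or> CARD('n) = 3"
    and "open \<Omega>" and "connected \<Omega>" and "\<Omega> \<noteq> {}" and "bounded \<Omega>"
    and "D3 \<in> sets lebesgue" and "bounded D3" and "D3 \<inter> \<Omega> = {}"
    and "\<gamma>LV > 0"
    and "-1 < (\<gamma>SV - \<gamma>SL) / \<gamma>LV" and "(\<gamma>SV - \<gamma>SL) / \<gamma>LV < 1"
    and "0 < \<theta>Y" and "\<theta>Y < pi" and "cos \<theta>Y = (\<gamma>SV - \<gamma>SL) / \<gamma>LV"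
    and "0 < V0" and "V0 < measure lebesgue \<Omega>"
    and "\<delta>t > 0"
    and "algorithmI \<Omega> D3 \<gamma>LV \<gamma>SL \<gamma>SV V0 \<delta>t N D1 D2
         \<or> algorithmII \<Omega> D3 \<gamma>LV \<theta>Y V0 \<delta>t N D1 D2"
    and "enat (Suc k) \<le> N"
  shows "energy \<Omega> D3 \<gamma>LV \<gamma>SL \<gamma>SV \<delta>t (indicator (D1 (Suc k))) (indicator (D2 (Suc k)))
         \<le> energy \<Omega> D3 \<gamma>LV \<gamma>SL \<gamma>SV \<delta>t (indicator (D1 k)) (indicator (D2 k))"
proof -
  note t = \<open>\<delta>t > 0\<close>
  have \<Omega>: "\<Omega> \<in> lmeasurable"
    using assms(2,5) by (rule lmeasurable_open[rotated])
  have D3: "D3 \<in> lmeasurable"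
    using assms(6,7) by (simp add: bounded_set_imp_lmeasurable)
  have young: "\<gamma>LV * cos \<theta>Y = \<gamma>SV - \<gamma>SL"
    using assms(9,14) by simp
  define h where "h A y = \<gamma>LV * (indicator (\<Omega> - A) y - indicator A y) + (\<gamma>SL - \<gamma>SV) * indicator D3 y"
    for A and y :: "real ^ 'n"
  have init: "initial_partition \<Omega> V0 (D1 0) (D2 0)"
    using assms(18) by (auto simp: algorithmI_def algorithmII_def)
  \<comment> \<open>The invariant of the iteration. Measurability belongs to it because the step
    relations do not assert it; the volume is kept so that consecutive iterates can be
    compared.\<close>
  define admissible where "admissible A B \<longleftrightarrow>
    A \<in> lmeasurable \<and> A \<subseteq> \<Omega> \<and> measure lebesgue A = V0 \<and> B = \<Omega> - A" for A B
  have step: "admissible (D1 (Suc j)) (D2 (Suc j)) \<and>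
      (\<exists>\<delta>. D1 (Suc j) = {x \<in> \<Omega>. (heat_kernel \<delta>t \<star> h (D1 j)) x < \<delta>})"
    if j: "enat (Suc j) \<le> N" and adm: "admissible (D1 j) (D2 j)" for j
  proof -
    have A: "D1 j \<in> lmeasurable" and B: "D2 j \<in> lmeasurable" and Beq: "D2 j = \<Omega> - D1 j"
      using adm \<Omega> by (auto simp: admissible_def fmeasurable_Diff)
    have alg: "stepI \<Omega> D3 \<gamma>LV \<gamma>SL \<gamma>SV V0 \<delta>t (D1 j) (D2 j) (D1 (Suc j)) (D2 (Suc j)) \<or>
        stepII \<Omega> D3 \<gamma>LV \<theta>Y V0 \<delta>t (D1 j) (D2 j) (D1 (Suc j)) (D2 (Suc j))"
      using assms(18) j by (auto simp: algorithmI_def algorithmII_def)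
    then obtain \<delta> where \<delta>: "D1 (Suc j) = {x \<in> \<Omega>. (heat_kernel \<delta>t \<star> h (D1 j)) x < \<delta>}"
      unfolding h_def Beq[symmetric]
    proof
      assume "stepI \<Omega> D3 \<gamma>LV \<gamma>SL \<gamma>SV V0 \<delta>t (D1 j) (D2 j) (D1 (Suc j)) (D2 (Suc j))"
      then show thesis
        by (rule stepI_threshold[OF _ t D3 A B]) (rule that[unfolded h_def Beq[symmetric]])
    next
      assume "stepII \<Omega> D3 \<gamma>LV \<theta>Y V0 \<delta>t (D1 j) (D2 j) (D1 (Suc j)) (D2 (Suc j))"
      then show thesis
        by (rule stepII_threshold[OF _ t young]) (rule that[unfolded h_def Beq[symmetric]])
    qed
    have [measurable]: "h (D1 j) \<in> borel_measurable lebesgue"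
      using A B D3 unfolding h_def Beq[symmetric] by (auto simp: fmeasurable_def)
    have [measurable]: "\<Omega> \<in> sets lebesgue" using \<Omega> by auto
    \<comment> \<open>The new phase is a sublevel set of a measurable potential, hence measurable;
      boundedness of \<Omega> then gives finite measure.\<close>
    have "{x \<in> space lebesgue. x \<in> \<Omega> \<and> (heat_kernel \<delta>t \<star> h (D1 j)) x < \<delta>} \<in> sets lebesgue"
      by measurable
    then have "D1 (Suc j) \<in> sets lebesgue" by (simp add: \<delta>)
    then have "D1 (Suc j) \<in> lmeasurable"
      using \<delta> assms(5) by (intro bounded_set_imp_lmeasurable) (auto intro: bounded_subset)
    then show ?thesis
      using alg \<delta> by (auto simp: admissible_def stepI_def stepII_def)
  qed
  have adm: "admissible (D1 j) (D2 j)" if "enat j \<le> N" for j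
    using that
  proof (induction j)
    case 0
    have "D1 0 \<subseteq> \<Omega>" "D2 0 = \<Omega> - D1 0" using init by (auto simp: initial_partition_def)
    then show ?case
      using init assms(5) by (auto simp: admissible_def initial_partition_def
          intro: bounded_set_imp_lmeasurable bounded_subset)
  next
    case (Suc j)
    then have "enat j \<le> N" by (metis Suc_ile_eq less_imp_le)
    then show ?case using Suc step by blast
  qed
  have k: "admissible (D1 k) (D2 k)"
    using adm assms(19) by (metis Suc_ile_eq less_imp_le)
  obtain \<delta> where \<delta>: "D1 (Suc k) = {x \<in> \<Omega>. (heat_kernel \<delta>t \<star> h (D1 k)) x < \<delta>}"
    and k': "admissible (D1 (Suc k)) (D2 (Suc k))"
    using step[OF assms(19) k] by blast
  \<comment> \<open>Both iterates have volume \<open>V0\<close> by admissibility, which supplies the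
    equal-volume hypothesis.\<close>
  show ?thesis
    using energy_threshold_le[OF t less_imp_le[OF assms(9)] \<Omega> D3, of "D1 k" "D1 (Suc k)"] k k' \<delta>
    by (auto simp: admissible_def h_def[abs_def])
qed

end
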